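(* Let $V=(v_{ij})_{1\le i,j\le N}$ be an $N\times N$ COE matrix. For positive integers $i,N,n$ with $1\le i\le N$, $$\mathbb{E}\left[|v_{ii}|^{2n}\right]=\frac{2^n\, n!}{(N+1)(N+3)\cdots(N+2n-1)}.$$
   Context: An $N\times N$ COE (circular orthogonal ensemble) matrix is a random symmetric unitary matrix $V$ distributed as $V=U^{\top}U$, where $U=(u_{ij})_{1\le i,j\le N}$ is a Haar-distributed random matrix from the unitary group $U(N)$ and $U^{\top}$ is its transpose (no complex conjugation); that is, $v_{ij}=\sum_{k=1}^N u_{ki}u_{kj}$. $\mathbb{E}$ denotes expectation. *)

theory Defs
  imports "HOL-Probability.Probability"
begin

definition conj_transpose :: "complex^'n^'m \<Rightarrow> complex^'m^'n" where
  "conj_transpose A = (\<chi> i j. cnj (A $ j $ i))"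

definition unitary_group :: "(complex^'n^'n) set" where
  "unitary_group = {U. U ** conj_transpose U = mat 1 \<and> conj_transpose U ** U = mat 1}"

text \<open>Normalized Haar measure on the unitary group, characterized by left translation
  invariance. Regularity is automatic for finite Borel measures on a compact metric space.
  Right invariance is automatic too, because the group is compact; it is not assumed.\<close>

definition haar_unitary :: "(complex^'n^'n) measure \<Rightarrow> bool" where
  "haar_unitary \<mu> \<longleftrightarrow>
     prob_space \<mu> \<and>
     sets \<mu> = sets (restrict_space borel unitary_group) \<and>
     (\<forall>W\<in>unitary_group. \<forall>A\<in>sets \<mu>. emeasure \<mu> ((\<lambda>U. W ** U) ` A) = emeasure \<mu> A)"

text \<open>A random matrix on \<open>M\<close> is COE if it has the law of \<open>transpose U ** U\<close> for Haar-distributed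
  \<open>U\<close>. The transpose is not conjugated. Only the law is constrained, so the matrix is symmetric
  and unitary almost surely rather than at every point of the sample space.\<close>

definition coe_matrix :: "'w measure \<Rightarrow> ('w \<Rightarrow> complex^'n^'n) \<Rightarrow> bool" where
  "coe_matrix M V \<longleftrightarrow>
     V \<in> borel_measurable M \<and>
     (\<exists>\<mu>. haar_unitary \<mu> \<and> distr M borel V = distr \<mu> borel (\<lambda>U. transpose U ** U))"

end

theory Submission
  imports Defs
begin

text \<open>The \<open>i\<close>-th column \<open>z\<close> of a Haar unitary has a law invariant under the unitary group, lives
  on the unit sphere, and \<open>v\<^sub>i\<^sub>i = q(z) = (\<Sum>k. z\<^sub>k\<^sup>2)\<close>. Differentiating the invariance of the expectation
  of \<open>z\<^sub>p z\<^sub>r q\<^sup>m cnj(q)\<^sup>l\<close> along the unitaries \<open>exp(\<i> t a a\<^sup>T)\<close>, \<open>a\<close> real,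
  polarising with \<open>a = e\<^sub>p + e\<^sub>r\<close>, and summing over \<open>p\<close> and \<open>r\<close> gives, for \<open>m = n - 1\<close> and \<open>l = n\<close>,
  \<open>(N + 2n - 1) E|q|\<^sup>2\<^sup>n = 2n E|q|\<^sup>2\<^sup>n\<^sup>-\<^sup>2\<close>, which is the asserted product formula.\<close>

section \<open>Rank-one perturbations of the identity and the quadratic form
  \<open>q\<close>\<close>

definition sqsum :: "complex^'n \<Rightarrow> complex" where
  "sqsum z = (\<Sum>k\<in>UNIV. (z $ k)\<^sup>2)"

text \<open>No conjugation is involved: \<open>a\<close> is real, so \<open>cnj (rdot a z)\<close>
  is the same pairing with the conjugate of \<open>z\<close>.\<close>

definition rdot :: "real^'n \<Rightarrow> complex^'n \<Rightarrow> complex" where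
  "rdot a z = (\<Sum>k\<in>UNIV. of_real (a $ k) * z $ k)"

text \<open>This is \<open>I + c a a^T\<close>. Since \<open>(a a^T)^2 = |a|^2 a a^T\<close>, every
  \<open>exp(\<i> t a a^T)\<close> with nonzero \<open>a\<close> has this form, with
  \<open>c = (exp(\<i> t |a|^2) - 1) / |a|^2\<close>.\<close>

definition rank_one_shift :: "complex \<Rightarrow> real^'n \<Rightarrow> complex^'n^'n" where
  "rank_one_shift c a = (\<chi> p r. (if p = r then 1 else 0) + c * of_real (a $ p) * of_real (a $ r))"

lemma rank_one_shift_mult:
  "rank_one_shift c a *v z = (\<chi> p. z $ p + c * rdot a z * of_real (a $ p))"
proof -
  have "(\<Sum>r\<in>UNIV. ((if p = r then 1 else 0) + c * of_real (a $ p) * of_real (a $ r)) * z $ r)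
      = z $ p + c * rdot a z * of_real (a $ p)" for p
  proof -
    have "(\<Sum>r\<in>UNIV. ((if p = r then 1 else 0) + c * of_real (a $ p) * of_real (a $ r)) * z $ r)
      = (\<Sum>r\<in>UNIV. (if p = r then z $ r else 0) + c * of_real (a $ p) * (of_real (a $ r) * z $ r))"
      by (rule sum.cong) (auto simp: algebra_simps)
    also have "\<dots> = z $ p + c * of_real (a $ p) * rdot a z"
      by (simp add: sum.distrib rdot_def flip: sum_distrib_left)
    finally show ?thesis by (simp add: ac_simps)
  qed
  thus ?thesis by (simp add: rank_one_shift_def matrix_vector_mult_def vec_eq_iff)
qed

lemma sum_sq_complex_norm:
  "(\<Sum>k\<in>UNIV. complex_of_real (a $ k) * of_real (a $ k)) = of_real ((norm (a::real^'n))\<^sup>2)"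
  by (simp add: norm_vec_def L2_set_def real_sqrt_pow2 sum_nonneg flip: power2_eq_square of_real_power)

text \<open>With \<open>d = c * rdot a z\<close> this shows how \<open>q\<close> moves under
  \<open>rank_one_shift c a\<close>: it gains \<open>(2 c + c^2 |a|^2) (rdot a z)^2\<close>.\<close>

lemma sqsum_shift:
  "sqsum (\<chi> p. z $ p + d * of_real (a $ p)) = sqsum z + 2 * d * rdot a z + d\<^sup>2 * of_real ((norm a)\<^sup>2)"
proof -
  have "sqsum (\<chi> p. z $ p + d * of_real (a $ p)) =
    (\<Sum>p\<in>UNIV. (z $ p)\<^sup>2 + 2 * d * (of_real (a $ p) * z $ p) + d\<^sup>2 * (of_real (a $ p) * of_real (a $ p)))"
    unfolding sqsum_def by (rule sum.cong) (auto simp: algebra_simps power2_eq_square)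
  also have "\<dots> = sqsum z + 2 * d * rdot a z + d\<^sup>2 * of_real ((norm a)\<^sup>2)"
    unfolding sum.distrib sum_distrib_left[symmetric] sum_sq_complex_norm
    by (simp add: sqsum_def rdot_def)
  finally show ?thesis .
qed

text \<open>Multiplying out,
  \<open>(I + c a a^T)(I + d a a^T) = I + (c + d + c d |a|^2) a a^T\<close>. The adjoint has
  \<open>d = cnj c\<close> because \<open>a\<close> is real, so the assumption makes it a two-sided
  inverse.\<close>

lemma rank_one_shift_unitary:
  assumes "c + cnj c + c * cnj c * of_real ((norm a)\<^sup>2) = 0"
  shows "rank_one_shift c a \<in> unitary_group"
proof -
  have prod: "rank_one_shift c a ** rank_one_shift d a = mat 1"
    if "c + d + c * d * of_real ((norm a)\<^sup>2) = 0" for c d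
  proof -
    have "(rank_one_shift c a ** rank_one_shift d a) $ p $ r = mat 1 $ p $ r" for p r
    proof -
      have "(rank_one_shift c a ** rank_one_shift d a) $ p $ r =
        (\<Sum>k\<in>UNIV. (if p = k then (if k = r then 1 else 0) else 0)
          + (if p = k then d * of_real (a $ k) * of_real (a $ r) else 0)
          + (if k = r then c * of_real (a $ p) * of_real (a $ k) else 0)
          + c * d * of_real (a $ p) * of_real (a $ r) * (of_real (a $ k) * of_real (a $ k)))"
        unfolding rank_one_shift_def matrix_matrix_mult_def
        by (simp, rule sum.cong) (auto simp: algebra_simps)
      also have "\<dots> = (if p = r then 1 else 0) + (c + d + c * d * of_real ((norm a)\<^sup>2)) *
          (of_real (a $ p) * of_real (a $ r))"
        unfolding sum.distrib sum_distrib_left[symmetric] sum_sq_complex_norm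
        by (simp add: algebra_simps)
      finally show ?thesis using that by (simp add: mat_def)
    qed
    thus ?thesis by (simp add: vec_eq_iff)
  qed
  have conj: "conj_transpose (rank_one_shift c a) = rank_one_shift (cnj c) a"
    by (auto simp: conj_transpose_def rank_one_shift_def vec_eq_iff)
  show ?thesis
    unfolding unitary_group_def mem_Collect_eq conj
    using assms prod[of c "cnj c"] prod[of "cnj c" c] by (simp add: algebra_simps)
qed

lemma continuous_sqsum [continuous_intros]:
  "continuous_on S f \<Longrightarrow> continuous_on S (\<lambda>x. sqsum (f x))"
  unfolding sqsum_def by (intro continuous_intros)

lemma continuous_rdot [continuous_intros]:
  "continuous_on S f \<Longrightarrow> continuous_on S (\<lambda>x. rdot a (f x))"
  unfolding rdot_def by (intro continuous_intros)

section \<open>Unitarily invariant laws on the unit sphere\<close>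

text \<open>Isolates the properties of the law of a Haar column from which the moments of
  \<open>sqsum\<close> follow. \<open>P\<close> lives on all of \<open>complex^'n\<close>, so the
  sphere condition is stated almost everywhere.\<close>

locale invariant_sphere_law = prob_space P for P :: "(complex^'n) measure" +
  assumes sets_P [measurable_cong]: "sets P = sets borel"
    and sphere: "AE z in P. norm z = 1"
    and invariant: "W \<in> unitary_group \<Longrightarrow> distr P borel (\<lambda>z. W *v z) = P"
begin

lemma borel_measurable_continuous:
  "continuous_on UNIV f \<Longrightarrow> f \<in> borel_measurable P" for f :: "complex^'n \<Rightarrow> complex"
  using borel_measurable_continuous_onI measurable_cong_sets[OF sets_P refl] by blast

text \<open>A continuous function is bounded on the compact unit sphere, which carries the finite
  measure \<open>P\<close>.\<close>

lemma integrable_continuous: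
  fixes f :: "complex^'n \<Rightarrow> complex"
  assumes "continuous_on UNIV f"
  shows "integrable P f"
proof -
  have "compact (f ` sphere 0 1)"
    using assms by (intro compact_continuous_image) (auto intro: continuous_on_subset)
  then obtain B where "\<forall>z\<in>sphere 0 1. norm (f z) \<le> B"
    by (auto dest!: compact_imp_bounded simp: bounded_iff)
  with sphere have "AE z in P. norm (f z) \<le> B" by (auto elim!: eventually_mono)
  thus ?thesis
    using borel_measurable_continuous[OF assms] by (intro integrable_const_bound)
qed

lemma expectation_unitary:
  fixes f :: "complex^'n \<Rightarrow> complex"
  assumes "W \<in> unitary_group" "continuous_on UNIV f"
  shows "expectation (\<lambda>z. f (W *v z)) = expectation f"
proof -
  have [measurable]: "f \<in> borel_measurable borel"
    using assms(2) by (rule borel_measurable_continuous_onI)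
  have "(\<lambda>z. W *v z) \<in> borel_measurable borel"
    by (intro borel_measurable_continuous_onI linear_continuous_on_compose[OF continuous_on_id])
       simp
  hence [measurable]: "(\<lambda>z. W *v z) \<in> measurable P borel"
    using measurable_cong_sets[OF sets_P refl] by blast
  have "expectation f = integral\<^sup>L (distr P borel (\<lambda>z. W *v z)) f"
    using invariant[OF assms(1)] by simp
  also have "\<dots> = expectation (\<lambda>z. f (W *v z))"
    by (rule integral_distr) measurable
  finally show ?thesis ..
qed

text \<open>Differentiation under the integral sign by dominated convergence. The parameter is
  complex so that holomorphic calculus applies, while constancy of the expectation is assumed at
  real parameters only.\<close>

lemma expectation_derivative_zero:
  fixes G G' :: "complex \<Rightarrow> complex^'n \<Rightarrow> complex"
  assumes deriv: "\<And>t z. ((\<lambda>t. G t z) has_field_derivative G' t z) (at t)"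
    and cont: "\<And>t. continuous_on UNIV (G t)"
    and cont': "continuous_on UNIV (\<lambda>x. G' (fst x) (snd x))"
    and const: "\<And>t. expectation (G (of_real t)) = expectation (G 0)"
  shows "expectation (G' 0) = 0"
proof -
  \<comment> \<open>The points \<open>1 / (m + 1)\<close> are real, so \<open>const\<close> applies,
    and they are nonzero, lie in the unit disc and tend to 0.\<close>
  define h :: "nat \<Rightarrow> complex" where "h m = of_real (inverse (real (Suc m)))" for m
  define Q where "Q m z = (G (h m) z - G 0 z) / h m" for m z
  have h0: "h m \<noteq> 0" and h1: "h m \<in> cball 0 1" for m
    by (auto simp: h_def norm_inverse inverse_le_1_iff simp del: of_nat_Suc)
  have hlim: "h \<longlonglongrightarrow> 0"
    using tendsto_of_real[OF LIMSEQ_inverse_real_of_nat, where 'a=complex]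
    by (simp add: h_def[abs_def])
  \<comment> \<open>Joint continuity bounds \<open>G'\<close> on the compact product of disc and
    sphere; this bound will dominate the difference quotients.\<close>
  have "compact ((\<lambda>x. G' (fst x) (snd x)) ` (cball 0 1 \<times> sphere 0 1))"
    using cont' by (intro compact_continuous_image compact_Times) (auto intro: continuous_on_subset)
  then obtain B where B: "\<And>t z. t \<in> cball 0 1 \<Longrightarrow> norm z = 1 \<Longrightarrow> norm (G' t z) \<le> B"
    by (fastforce dest!: compact_imp_bounded simp: bounded_iff)
  have Qint: "expectation (Q m) = 0" for m
    unfolding Q_def using const[of "inverse (real (Suc m))"] cont
    by (simp add: h_def integrable_continuous)
  have "(\<lambda>m. expectation (Q m)) \<longlonglongrightarrow> expectation (G' 0)"
  proof (rule integral_dominated_convergence[where w="\<lambda>_. B"])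
    show "G' 0 \<in> borel_measurable P"
      using continuous_on_compose2[OF cont' continuous_on_Pair[OF continuous_on_const continuous_on_id]]
      by (intro borel_measurable_continuous) auto
    show "Q m \<in> borel_measurable P" for m
      unfolding Q_def using h0 cont by (intro borel_measurable_continuous continuous_intros) auto
    show "AE z in P. (\<lambda>m. Q m z) \<longlonglongrightarrow> G' 0 z"
    proof (rule AE_I2)
      fix z
      have "((\<lambda>t. (G t z - G 0 z) / t) \<longlongrightarrow> G' 0 z) (at 0)"
        using deriv[of z 0] by (simp add: has_field_derivative_iff)
      thus "(\<lambda>m. Q m z) \<longlonglongrightarrow> G' 0 z"
        unfolding Q_def
        by (rule filterlim_compose) (use hlim h0 in \<open>auto simp: filterlim_at\<close>)
    qed
    show "AE z in P. norm (Q m z) \<le> B" for m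
      using sphere
    proof eventually_elim
      case (elim z)
      \<comment> \<open>Mean value inequality on the convex unit disc.\<close>
      have "norm (G (h m) z - G 0 z) \<le> B * norm (h m - 0)"
        by (rule field_differentiable_bound[of "cball 0 1" "\<lambda>t. G t z" "\<lambda>t. G' t z"])
           (use elim h1 B deriv in \<open>auto intro: has_field_derivative_at_within\<close>)
      thus ?case using h0[of m] by (simp add: Q_def norm_divide divide_le_eq)
    qed
  qed auto
  hence "(\<lambda>m::nat. 0) \<longlonglongrightarrow> expectation (G' 0)" by (simp add: Qint)
  thus ?thesis by (simp add: LIMSEQ_const_iff)
qed

text \<open>Up to a factor \<i>, the derivative at \<open>t = 0\<close> of
  \<open>z_p z_r q^m cnj(q)^l\<close> along \<open>exp(\<i> t a a^T)\<close>, where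
  \<open>z\<close>, \<open>q\<close> and \<open>cnj q\<close> have derivatives
  \<open>\<i> (rdot a z) a\<close>, \<open>2 \<i> (rdot a z)^2\<close> and
  \<open>- 2 \<i> (cnj (rdot a z))^2\<close>. Truncation in \<open>m - 1\<close> and
  \<open>l - 1\<close> is harmless, as the factors \<open>m\<close> and \<open>l\<close> then
  vanish.\<close>

definition generator :: "nat \<Rightarrow> nat \<Rightarrow> 'n \<Rightarrow> 'n \<Rightarrow> real^'n \<Rightarrow> complex^'n \<Rightarrow> complex" where
  "generator m l p r a z =
     rdot a z * (of_real (a $ p) * z $ r + of_real (a $ r) * z $ p) * sqsum z ^ m * cnj (sqsum z) ^ l
   + 2 * of_nat m * (rdot a z)\<^sup>2 * z $ p * z $ r * sqsum z ^ (m - 1) * cnj (sqsum z) ^ l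
   - 2 * of_nat l * (cnj (rdot a z))\<^sup>2 * z $ p * z $ r * sqsum z ^ m * cnj (sqsum z) ^ (l - 1)"

lemma continuous_generator: "continuous_on S (generator m l p r a)"
  unfolding generator_def by (intro continuous_intros)

text \<open>Invariance makes the expectation constant along the one-parameter group, so its
  derivative vanishes. For nonzero \<open>a\<close> the coefficients below may be divided by
  \<open>\<kappa> = |a|^2\<close>.\<close>

lemma expectation_generator:
  assumes "a \<noteq> 0"
  shows "expectation (generator m l p r a) = 0"
proof -
  define \<kappa> :: complex where "\<kappa> = of_real ((norm a)\<^sup>2)"
  have k0: "\<kappa> \<noteq> 0" using assms by (simp add: \<kappa>_def)
  have kc: "cnj \<kappa> = \<kappa>" by (simp add: \<kappa>_def)
  \<comment> \<open>\<open>c\<close> makes \<open>rank_one_shift (c t) a\<close> equal to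
    \<open>exp(\<i> t a a^T)\<close>; \<open>e = 2 c + c^2 \<kappa>\<close> is the resulting
    coefficient in \<open>q\<close>.\<close>
  define c where "c t = (exp (\<i> * \<kappa> * t) - 1) / \<kappa>" for t
  define e where "e t = (exp (2 * \<i> * \<kappa> * t) - 1) / \<kappa>" for t
  text \<open>On the real axis \<open>d\<close> is the conjugate of \<open>e\<close>, but unlike the conjugate it is entire.\<close>
  define d where "d t = (exp (- (2 * \<i> * \<kappa> * t)) - 1) / \<kappa>" for t
  define f where "f z = z $ p * z $ r * sqsum z ^ m * cnj (sqsum z) ^ l" for z :: "complex^'n"
  \<comment> \<open>\<open>A\<close>, \<open>B\<close>, \<open>C\<close>, \<open>D\<close> are the
    transformed factors \<open>z_p\<close>, \<open>z_r\<close>, \<open>q\<close> and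
    \<open>cnj q\<close>, each entire in \<open>t\<close>; \<open>G\<close> is the transformed
    monomial and \<open>G'\<close> its derivative by the product rule.\<close>
  define A where "A t z = z $ p + c t * rdot a z * of_real (a $ p)" for t and z :: "complex^'n"
  define B where "B t z = z $ r + c t * rdot a z * of_real (a $ r)" for t and z :: "complex^'n"
  define C where "C t z = sqsum z + e t * (rdot a z)\<^sup>2" for t and z :: "complex^'n"
  define D where "D t z = cnj (sqsum z) + d t * (cnj (rdot a z))\<^sup>2" for t and z :: "complex^'n"
  define G where "G t z = A t z * B t z * C t z ^ m * D t z ^ l" for t z
  define c' where "c' t = \<i> * exp (\<i> * \<kappa> * t)" for t
  define e' where "e' t = 2 * \<i> * exp (2 * \<i> * \<kappa> * t)" for t
  define d' where "d' t = - (2 * \<i> * exp (- (2 * \<i> * \<kappa> * t)))" for t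
  define G' where "G' t z =
     (c' t * rdot a z * of_real (a $ p) * B t z + A t z * (c' t * rdot a z * of_real (a $ r))) * C t z ^ m * D t z ^ l
   + A t z * B t z * (of_nat m * C t z ^ (m - 1) * (e' t * (rdot a z)\<^sup>2)) * D t z ^ l
   + A t z * B t z * C t z ^ m * (of_nat l * D t z ^ (l - 1) * (d' t * (cnj (rdot a z))\<^sup>2))" for t z
  note coeff = c_def e_def d_def c'_def e'_def d'_def
  have dc: "(c has_field_derivative c' t) (at t)" for t
    unfolding c_def[abs_def] c'_def using k0 by (auto intro!: derivative_eq_intros)
  have de: "(e has_field_derivative e' t) (at t)" for t
    unfolding e_def[abs_def] e'_def using k0 by (auto intro!: derivative_eq_intros)
  have dd: "(d has_field_derivative d' t) (at t)" for t
    unfolding d_def[abs_def] d'_def using k0 by (auto intro!: derivative_eq_intros)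
  \<comment> \<open>Restricted to real \<open>t\<close>, since only there is \<open>D\<close> the
    conjugate of \<open>C\<close>.\<close>
  have G_eq: "G (of_real t) z = f (rank_one_shift (c (of_real t)) a *v z)" for t z
  proof -
    have ec: "e s = 2 * c s + (c s)\<^sup>2 * \<kappa>" for s
    proof -
      have "exp (2 * \<i> * \<kappa> * s) = (exp (\<i> * \<kappa> * s))\<^sup>2"
        by (simp add: algebra_simps flip: exp_double)
      thus ?thesis using k0 by (simp add: e_def c_def field_simps power2_eq_square)
    qed
    have "sqsum (\<chi> p. z $ p + c (of_real t) * rdot a z * of_real (a $ p)) = C (of_real t) z"
      unfolding sqsum_shift C_def ec by (simp add: \<kappa>_def algebra_simps power2_eq_square)
    moreover have "cnj (C (of_real t) z) = D (of_real t) z"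
      by (simp add: C_def D_def e_def d_def kc exp_cnj)
    ultimately show ?thesis
      by (simp add: rank_one_shift_mult G_def f_def A_def B_def)
  qed
  have cf: "continuous_on UNIV f"
    unfolding f_def by (intro continuous_intros)
  have G0: "G 0 = f"
    by (rule ext) (simp add: G_def f_def A_def B_def C_def D_def coeff)
  have "expectation (G' 0) = 0"
  proof (rule expectation_derivative_zero)
    show "((\<lambda>t. G t z) has_field_derivative G' t z) (at t)" for t z
      unfolding G_def G'_def A_def B_def C_def D_def
      by (rule derivative_eq_intros dc de dd refl)+ (simp add: algebra_simps)
    show "continuous_on UNIV (G t)" for t
      unfolding G_def A_def B_def C_def D_def by (intro continuous_intros)
    show "continuous_on UNIV (\<lambda>x. G' (fst x) (snd x))"
    proof -
      have "continuous_on S c" "continuous_on S e" "continuous_on S d"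
        "continuous_on S c'" "continuous_on S e'" "continuous_on S d'" for S
        unfolding coeff[abs_def] using k0 by (intro continuous_intros; simp)+
      note coeff_cont = this[THEN continuous_on_compose2, OF _ subset_UNIV]
      have vec_cont: "continuous_on UNIV (\<lambda>x :: complex \<times> (complex^'n). snd x $ k)" for k
        by (intro continuous_intros)
      have fst_cont: "continuous_on UNIV (\<lambda>x :: complex \<times> (complex^'n). fst x)"
        and snd_cont: "continuous_on UNIV (\<lambda>x :: complex \<times> (complex^'n). snd x)"
        by (intro continuous_intros)+
      note basic = coeff_cont[OF fst_cont] vec_cont continuous_sqsum[OF snd_cont]
        continuous_rdot[OF snd_cont] continuous_on_const
      note arith = continuous_on_add continuous_on_mult continuous_on_power continuous_on_cnj
      show ?thesis
        unfolding G'_def A_def B_def C_def D_def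
        by (intro arith basic)
    qed
    show "expectation (G (of_real t)) = expectation (G 0)" for t
    proof -
      have "cnj (c (of_real t)) = (exp (- (\<i> * \<kappa> * of_real t)) - 1) / \<kappa>"
        by (simp add: c_def kc exp_cnj)
      \<comment> \<open>\<open>1 + \<kappa> c\<close> is \<open>exp(\<i> \<kappa> t)\<close>, of
        modulus one; expanding and cancelling \<open>\<kappa>\<close> leaves the unitarity
        condition.\<close>
      hence "(1 + \<kappa> * c (of_real t)) * (1 + \<kappa> * cnj (c (of_real t))) = 1"
        using k0 by (simp add: c_def flip: exp_add)
      hence "\<kappa> * (c (of_real t) + cnj (c (of_real t)) + c (of_real t) * cnj (c (of_real t)) * \<kappa>) = 0"
        by (simp add: algebra_simps)
      hence "rank_one_shift (c (of_real t)) a \<in> unitary_group"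
        using k0 by (intro rank_one_shift_unitary) (simp add: \<kappa>_def)
      thus ?thesis
        using expectation_unitary[OF _ cf] by (simp add: G_eq[abs_def] G0)
    qed
  qed
  \<comment> \<open>At \<open>t = 0\<close> the coefficients \<open>c\<close>, \<open>e\<close>,
    \<open>d\<close> vanish and their derivatives are \<i>, \<open>2 \<i>\<close> and
    \<open>- 2 \<i>\<close>.\<close>
  also have "G' 0 = (\<lambda>z. \<i> * generator m l p r a z)"
    by (rule ext) (simp add: G'_def A_def B_def C_def D_def coeff generator_def algebra_simps)
  finally show ?thesis
    by (simp add: integrable_continuous[OF continuous_generator])
qed

text \<open>The generator is quadratic in \<open>a\<close>, so the combination extracts its cross
  term at the axis vectors \<open>p\<close> and \<open>r\<close>. Summation then only needs that the
  \<open>z_p^2\<close> add up to \<open>q\<close> and the \<open>|z_p|^2\<close> to 1.\<close>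

lemma sum_polarised_generator:
  assumes "norm z = 1"
  shows "(\<Sum>p\<in>UNIV. \<Sum>r\<in>UNIV. generator m l p r (axis p 1 + axis r 1) z
      - generator m l p r (axis p 1) z - generator m l p r (axis r 1) z)
    = 2 * (of_nat CARD('n) + 1 + 2 * of_nat m) * sqsum z ^ Suc m * cnj (sqsum z) ^ l
      - 4 * of_nat l * sqsum z ^ m * cnj (sqsum z) ^ (l - 1)"
proof -
  let ?q = "sqsum z"
  let ?\<alpha> = "?q ^ m * cnj ?q ^ l" and ?\<beta> = "4 * of_nat m * ?q ^ (m - 1) * cnj ?q ^ l"
    and ?\<gamma> = "4 * of_nat l * ?q ^ m * cnj ?q ^ (l - 1)"
  have dot: "rdot (axis p 1) z = z $ p" for p
    by (simp add: rdot_def axis_def if_distrib[of of_real] if_distrib[of "\<lambda>x. x * _"] cong: if_cong)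
  have dot_add: "rdot (a + b) z = rdot a z + rdot b z" for a b
    by (simp add: rdot_def distrib_right sum.distrib)
  have norm1: "(\<Sum>p\<in>UNIV. z $ p * cnj (z $ p)) = 1"
  proof -
    have "(\<Sum>p\<in>UNIV. z $ p * cnj (z $ p)) = of_real ((norm z)\<^sup>2)"
      by (simp only: complex_mult_cnj cmod_power2[symmetric])
         (simp add: norm_vec_def L2_set_def real_sqrt_pow2 sum_nonneg)
    thus ?thesis using assms by simp
  qed
  \<comment> \<open>On the diagonal the first vector is twice \<open>axis p 1\<close>, which gives
    the extra term at \<open>p = r\<close> and eventually the 1 in \<open>N + 1\<close>.\<close>
  have "generator m l p r (axis p 1 + axis r 1) z
      - generator m l p r (axis p 1) z - generator m l p r (axis r 1) z
    = (z $ p)\<^sup>2 * ?\<alpha> + (z $ r)\<^sup>2 * ?\<alpha> + (if p = r then 2 * (z $ r)\<^sup>2 * ?\<alpha> else 0)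
      + (z $ p)\<^sup>2 * ((z $ r)\<^sup>2 * ?\<beta>) - z $ p * cnj (z $ p) * (z $ r * cnj (z $ r) * ?\<gamma>)" for p r
    unfolding generator_def dot dot_add
    by (cases "p = r") (simp_all add: axis_def algebra_simps power2_eq_square)
  hence "(\<Sum>p\<in>UNIV. \<Sum>r\<in>UNIV. generator m l p r (axis p 1 + axis r 1) z
      - generator m l p r (axis p 1) z - generator m l p r (axis r 1) z)
    = (\<Sum>p\<in>UNIV. of_nat CARD('n) * ((z $ p)\<^sup>2 * ?\<alpha>) + ?q * ?\<alpha> + 2 * (z $ p)\<^sup>2 * ?\<alpha>
      + (z $ p)\<^sup>2 * (?q * ?\<beta>) - z $ p * cnj (z $ p) * ?\<gamma>)"
    by (simp add: sum.distrib sum_subtractf norm1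
        flip: sum_distrib_left sum_distrib_right sqsum_def)
  also have "\<dots> = of_nat CARD('n) * (?q * ?\<alpha>) + of_nat CARD('n) * (?q * ?\<alpha>) + 2 * ?q * ?\<alpha>
      + ?q * (?q * ?\<beta>) - ?\<gamma>"
    by (simp add: sum.distrib sum_subtractf norm1
        flip: sum_distrib_left sum_distrib_right sqsum_def)
  \<comment> \<open>The case split turns \<open>q * q * q ^ (m - 1)\<close> into
    \<open>q ^ Suc m\<close> for positive \<open>m\<close>; for \<open>m = 0\<close> the term
    vanishes.\<close>
  also have "\<dots> = 2 * (of_nat CARD('n) + 1 + 2 * of_nat m) * ?q ^ Suc m * cnj ?q ^ l - ?\<gamma>"
    by (cases m) (simp_all add: algebra_simps)
  finally show ?thesis .
qed

text \<open>Choosing \<open>m = n\<close> and \<open>l = n + 1\<close> balances both monomials of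
  the polarised sum: they become \<open>|q|^(2n+2)\<close> and \<open>|q|^(2n)\<close>.\<close>

lemma moment_recursion:
  "(real CARD('n) + 2 * real n + 1) * expectation (\<lambda>z. cmod (sqsum z) ^ (2 * Suc n))
    = 2 * real (Suc n) * expectation (\<lambda>z. cmod (sqsum z) ^ (2 * n))"
proof -
  define g where "g p r a = generator n (Suc n) p r a" for p r :: 'n and a
  have int: "integrable P (g p r a)" for p r a
    unfolding g_def by (intro integrable_continuous continuous_generator)
  have zero: "expectation (g p r a) = 0" if "a \<noteq> 0" for p r a
    unfolding g_def using that by (rule expectation_generator)
  \<comment> \<open>Coordinate \<open>p\<close> is positive in both vectors; in the second it is 2
    when \<open>p = r\<close>.\<close>
  have axis: "axis p 1 \<noteq> (0 :: real^'n)" "axis p 1 + axis r 1 \<noteq> (0 :: real^'n)" for p r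
    by (auto simp: vec_eq_iff axis_def intro!: exI[of _ p])
  have absq: "sqsum z ^ k * cnj (sqsum z) ^ k = of_real (cmod (sqsum z) ^ (2 * k))" for z :: "complex^'n" and k
    by (simp add: power_mult power_mult_distrib[symmetric] complex_norm_square[symmetric])
  have intq: "integrable P (\<lambda>z. complex_of_real (cmod (sqsum z) ^ k))" for k
    by (intro integrable_continuous continuous_intros)
  define x where "x = expectation (\<lambda>z. cmod (sqsum z) ^ (2 * Suc n))"
  define y where "y = expectation (\<lambda>z. cmod (sqsum z) ^ (2 * n))"
  have "0 = expectation (\<lambda>z. \<Sum>p\<in>UNIV. \<Sum>r\<in>UNIV.
      g p r (axis p 1 + axis r 1) z - g p r (axis p 1) z - g p r (axis r 1) z)"
    by (simp add: int zero axis Bochner_Integration.integral_sum)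
  also have "\<dots> = expectation (\<lambda>z.
      2 * of_real (real CARD('n) + 2 * real n + 1) * of_real (cmod (sqsum z) ^ (2 * Suc n))
      - 4 * of_real (real (Suc n)) * of_real (cmod (sqsum z) ^ (2 * n)))"
  \<comment> \<open>The summed identity relies on \<open>norm z = 1\<close>, so the integrands agree
    only almost everywhere.\<close>
  proof (rule integral_cong_AE)
    show "AE z in P. (\<Sum>p\<in>UNIV. \<Sum>r\<in>UNIV.
        g p r (axis p 1 + axis r 1) z - g p r (axis p 1) z - g p r (axis r 1) z)
      = 2 * of_real (real CARD('n) + 2 * real n + 1) * of_real (cmod (sqsum z) ^ (2 * Suc n))
      - 4 * of_real (real (Suc n)) * of_real (cmod (sqsum z) ^ (2 * n))"
      using sphere
    proof eventually_elim
      case (elim z)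
      show ?case
        unfolding g_def sum_polarised_generator[OF elim] absq[symmetric]
        by (simp add: algebra_simps)
    qed
    show "(\<lambda>z. \<Sum>p\<in>UNIV. \<Sum>r\<in>UNIV.
        g p r (axis p 1 + axis r 1) z - g p r (axis p 1) z - g p r (axis r 1) z) \<in> borel_measurable P"
      using int by (intro borel_measurable_integrable) auto
  qed (intro borel_measurable_continuous continuous_intros)
  also have "\<dots> = of_real (2 * ((real CARD('n) + 2 * real n + 1) * x) - 4 * (real (Suc n) * y))"
    using intq[of "2 * Suc n"] intq[of "2 * n"] unfolding x_def y_def
    by (simp del: mult_Suc_right of_nat_Suc of_real_power)
  finally have "of_real (2 * ((real CARD('n) + 2 * real n + 1) * x) - 4 * (real (Suc n) * y)) = (0 :: complex)"
    by (rule sym)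
  hence "(real CARD('n) + 2 * real n + 1) * x = 2 * real (Suc n) * y"
    unfolding of_real_eq_0_iff by (simp add: algebra_simps)
  thus ?thesis unfolding x_def y_def .
qed

text \<open>The recursion multiplies by \<open>2 (n + 1) / (N + 2 n + 1)\<close>, whose denominator
  is the product's factor at \<open>k = n + 1\<close>.\<close>

lemma moment_formula:
  "expectation (\<lambda>z. cmod (sqsum z) ^ (2 * n))
    = 2 ^ n * fact n / (\<Prod>k=1..n. real CARD('n) + 2 * real k - 1)"
proof (induction n)
  case 0
  show ?case by (simp add: prob_space)
next
  case (Suc n)
  have "real CARD('n) + 2 * real n + 1 > 0" by (simp add: add_pos_nonneg)
  hence "expectation (\<lambda>z. cmod (sqsum z) ^ (2 * Suc n))
      = 2 * real (Suc n) * expectation (\<lambda>z. cmod (sqsum z) ^ (2 * n)) / (real CARD('n) + 2 * real n + 1)"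
    using moment_recursion[of n] by (simp add: field_simps del: mult_Suc_right of_nat_Suc)
  thus ?case
    unfolding Suc.IH by (simp add: field_simps del: mult_Suc_right)
qed

end

section \<open>Columns of a Haar unitary\<close>

text \<open>Haar invariance is phrased with images, a push-forward with preimages. The preimage
  under \<open>W\<close> is the image under its inverse \<open>conj_transpose W\<close>, which again
  lies in the group.\<close>

lemma haar_distr:
  fixes \<mu> :: "(complex^'n^'n) measure"
  assumes haar: "haar_unitary \<mu>" and W: "W \<in> unitary_group"
  shows "(\<lambda>U. W ** U) \<in> measurable \<mu> \<mu>" "distr \<mu> \<mu> (\<lambda>U. W ** U) = \<mu>"
proof -
  have sets: "sets \<mu> = sets (restrict_space borel unitary_group)"
    using haar by (simp add: haar_unitary_def)
  hence space: "space \<mu> = unitary_group"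
    using sets_eq_imp_space_eq[OF sets] by (simp add: space_restrict_space)
  let ?W = "conj_transpose W"
  have inv: "W ** ?W = mat 1" "?W ** W = mat 1"
    using W by (auto simp: unitary_group_def)
  have conj_mult: "conj_transpose (A ** B) = conj_transpose B ** conj_transpose A" for A B :: "complex^'n^'n"
    by (simp add: conj_transpose_def matrix_matrix_mult_def vec_eq_iff mult.commute)
  have conj_conj: "conj_transpose (conj_transpose A) = A" for A :: "complex^'n^'n"
    by (simp add: conj_transpose_def vec_eq_iff)
  have W': "?W \<in> unitary_group"
    using inv by (simp add: unitary_group_def conj_conj)
  have closed: "A ** B \<in> unitary_group" if "A \<in> unitary_group" "B \<in> unitary_group" for A B :: "complex^'n^'n"
    using that unfolding unitary_group_def mem_Collect_eq conj_mult
    by (metis matrix_mul_assoc matrix_mul_rid)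
  have cancel: "W ** (?W ** U) = U" "?W ** (W ** U) = U" for U :: "complex^'n^'n"
    by (simp_all add: matrix_mul_assoc inv)
  have "continuous_on UNIV (\<lambda>U. W ** U)"
    unfolding matrix_matrix_mult_def by (intro continuous_intros)
  hence "(\<lambda>U. W ** U) \<in> borel_measurable borel"
    by (rule borel_measurable_continuous_onI)
  hence "(\<lambda>U. W ** U) \<in> measurable (restrict_space borel unitary_group) (restrict_space borel unitary_group)"
    using closed[OF W] by (intro measurable_restrict_space3) auto
  thus meas: "(\<lambda>U. W ** U) \<in> measurable \<mu> \<mu>"
    using measurable_cong_sets[OF sets sets] by blast
  show "distr \<mu> \<mu> (\<lambda>U. W ** U) = \<mu>"
  proof (rule measure_eqI)
    fix A assume "A \<in> sets (distr \<mu> \<mu> (\<lambda>U. W ** U))"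
    hence A: "A \<in> sets \<mu>" by simp
    hence AU: "A \<subseteq> unitary_group" using sets.sets_into_space space by blast
    have "(\<lambda>U. W ** U) -` A \<inter> space \<mu> = (\<lambda>U. ?W ** U) ` A"
    proof (intro equalityI subsetI)
      fix U assume "U \<in> (\<lambda>U. W ** U) -` A \<inter> space \<mu>"
      thus "U \<in> (\<lambda>U. ?W ** U) ` A"
        by (intro image_eqI[of _ _ "W ** U"]) (auto simp: cancel)
    qed (use AU closed[OF W'] in \<open>auto simp: cancel space\<close>)
    thus "emeasure (distr \<mu> \<mu> (\<lambda>U. W ** U)) A = emeasure \<mu> A"
      using haar W' A by (simp add: emeasure_distr[OF meas A] haar_unitary_def)
  qed simp
qed

text \<open>Column \<open>i\<close> of \<open>W ** U\<close> is \<open>W\<close> applied to column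
  \<open>i\<close> of \<open>U\<close>, so left invariance passes to the column.\<close>

lemma haar_column:
  fixes \<mu> :: "(complex^'n^'n) measure"
  assumes haar: "haar_unitary \<mu>"
  shows "column i \<in> borel_measurable \<mu>" "invariant_sphere_law (distr \<mu> borel (column i))"
proof -
  interpret mu: prob_space \<mu> using haar by (simp add: haar_unitary_def)
  have sets: "sets \<mu> = sets (restrict_space borel unitary_group)"
    using haar by (simp add: haar_unitary_def)
  hence space: "space \<mu> = unitary_group"
    using sets_eq_imp_space_eq[OF sets] by (simp add: space_restrict_space)
  have "continuous_on UNIV (column i :: complex^'n^'n \<Rightarrow> _)"
    unfolding column_def by (intro continuous_intros)
  hence "(column i :: complex^'n^'n \<Rightarrow> _) \<in> borel_measurable (restrict_space borel unitary_group)"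
    by (intro measurable_restrict_space1 borel_measurable_continuous_onI)
  thus meas [measurable]: "column i \<in> borel_measurable \<mu>"
    using measurable_cong_sets[OF sets refl] by blast
  show "invariant_sphere_law (distr \<mu> borel (column i))"
  proof (intro invariant_sphere_law.intro invariant_sphere_law_axioms.intro)
    show "prob_space (distr \<mu> borel (column i))" by (rule mu.prob_space_distr) measurable
    have "norm (column i U) = 1" if "U \<in> unitary_group" for U :: "complex^'n^'n"
    proof -
      \<comment> \<open>This is the diagonal entry \<open>i\<close> of
        \<open>conj_transpose U ** U = mat 1\<close>.\<close>
      have "(\<Sum>k\<in>UNIV. cnj (U $ k $ i) * U $ k $ i) = 1"
        using that by (auto simp: unitary_group_def conj_transpose_def matrix_matrix_mult_def mat_def vec_eq_iff)
      also have "(\<Sum>k\<in>UNIV. cnj (U $ k $ i) * U $ k $ i) = of_real (\<Sum>k\<in>UNIV. (cmod (U $ k $ i))\<^sup>2)"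
        by (simp only: of_real_sum complex_norm_square mult.commute)
      finally have "(\<Sum>k\<in>UNIV. (cmod (U $ k $ i))\<^sup>2) = 1"
        using of_real_eq_1_iff by blast
      thus ?thesis by (simp add: norm_vec_def L2_set_def column_def)
    qed
    thus "AE z in distr \<mu> borel (column i). norm z = 1"
      by (subst AE_distr_iff) (auto simp: space)
    fix W :: "complex^'n^'n" assume W: "W \<in> unitary_group"
    note haar_distr [OF haar W, measurable (raw)]
    have [measurable]: "(\<lambda>z. W *v z) \<in> borel_measurable borel"
      by (intro borel_measurable_continuous_onI linear_continuous_on_compose[OF continuous_on_id]) simp
    have "distr (distr \<mu> borel (column i)) borel (\<lambda>z. W *v z) = distr \<mu> borel (\<lambda>U. W *v column i U)"
      by (simp add: distr_distr comp_def)
    also have "(\<lambda>U. W *v column i U) = (\<lambda>U. column i (W ** U))"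
      by (simp add: fun_eq_iff vec_eq_iff column_def matrix_vector_mult_def matrix_matrix_mult_def)
    also have "distr \<mu> borel \<dots> = distr (distr \<mu> \<mu> (\<lambda>U. W ** U)) borel (column i)"
      using haar_distr(1)[OF haar W] by (simp add: distr_distr comp_def)
    also have "\<dots> = distr \<mu> borel (column i)"
      by (simp only: haar_distr(2)[OF haar W])
    finally show "distr (distr \<mu> borel (column i)) borel (\<lambda>z. W *v z) = distr \<mu> borel (column i)" .
  qed simp
qed

section \<open>Diagonal entries of a COE matrix\<close>

theorem theorem1p1:
  fixes M :: "'w measure"
    and V :: "'w \<Rightarrow> complex^'n^'n"
    and i :: 'n
    and n :: nat
  assumes "prob_space M"
    and "coe_matrix M V"
    and "n > 0"
  shows "prob_space.expectation M (\<lambda>\<omega>. cmod (V \<omega> $ i $ i) ^ (2 * n))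
    = 2 ^ n * fact n / (\<Prod>k=1..n. real CARD('n) + 2 * real k - 1)"
proof -
  from assms(2) obtain \<mu> where V [measurable]: "V \<in> borel_measurable M" and haar: "haar_unitary \<mu>"
    and law: "distr M borel V = distr \<mu> borel (\<lambda>U. transpose U ** U)"
    by (auto simp: coe_matrix_def)
  interpret column_law: invariant_sphere_law "distr \<mu> borel (column i)"
    using haar by (rule haar_column)
  have [measurable]: "(\<lambda>A :: complex^'n^'n. cmod (A $ i $ i) ^ (2 * n)) \<in> borel_measurable borel"
    by (intro borel_measurable_continuous_onI continuous_intros)
  have [measurable]: "(\<lambda>z :: complex^'n. cmod (sqsum z) ^ (2 * n)) \<in> borel_measurable borel"
    by (intro borel_measurable_continuous_onI continuous_intros)
  have sets: "sets \<mu> = sets (restrict_space borel unitary_group)"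
    using haar by (simp add: haar_unitary_def)
  have "continuous_on UNIV (\<lambda>U :: complex^'n^'n. transpose U ** U)"
    unfolding matrix_matrix_mult_def transpose_def by (intro continuous_intros)
  hence "(\<lambda>U :: complex^'n^'n. transpose U ** U) \<in> borel_measurable (restrict_space borel unitary_group)"
    by (intro measurable_restrict_space1 borel_measurable_continuous_onI)
  hence [measurable]: "(\<lambda>U. transpose U ** U) \<in> borel_measurable \<mu>"
    using measurable_cong_sets[OF sets refl] by blast
  \<comment> \<open>The moment depends only on the law of \<open>V\<close>, so it is moved to \<mu>
    and from there to the law of column \<open>i\<close>.\<close>
  have "prob_space.expectation M (\<lambda>\<omega>. cmod (V \<omega> $ i $ i) ^ (2 * n))
    = integral\<^sup>L (distr M borel V) (\<lambda>A. cmod (A $ i $ i) ^ (2 * n))"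
    by (rule integral_distr[symmetric]) measurable
  also have "\<dots> = integral\<^sup>L \<mu> (\<lambda>U. cmod ((transpose U ** U) $ i $ i) ^ (2 * n))"
    unfolding law by (rule integral_distr) measurable
  also have "(\<lambda>U. (transpose U ** U) $ i $ i) = (\<lambda>U. sqsum (column i U))"
    by (simp add: fun_eq_iff matrix_matrix_mult_def transpose_def sqsum_def column_def power2_eq_square)
  hence "integral\<^sup>L \<mu> (\<lambda>U. cmod ((transpose U ** U) $ i $ i) ^ (2 * n))
      = integral\<^sup>L \<mu> (\<lambda>U. cmod (sqsum (column i U)) ^ (2 * n))"
    by metis
  also have "\<dots> = integral\<^sup>L (distr \<mu> borel (column i)) (\<lambda>z. cmod (sqsum z) ^ (2 * n))"
    by (rule integral_distr[OF haar_column(1)[OF haar], symmetric]) measurable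
  also have "\<dots> = 2 ^ n * fact n / (\<Prod>k=1..n. real CARD('n) + 2 * real k - 1)"
    by (rule column_law.moment_formula)
  finally show ?thesis .
qed

end
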